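(* Let $k\ge 3$, $n=k+1$, and reals $s_1,\dots,s_{k-1}$. For any $a,b\in S_k$ with $a\succ_k b$ there is a continuous function $p:[0,1]\to S_k$ with $p(0)=b$, $p(1)=a$, and $p(t_1)\succ_k p(t_0)$ whenever $t_1\ge t_0$.
   Context: $S_k:=\{(x_1,\dots,x_n)\in\mathbb{R}^n : x_1\ge\cdots\ge x_n,\ \sum_{i=1}^n x_i^j=s_j\text{ for }j=1,\dots,k-1\}$ with the subspace topology from $\mathbb{R}^n$. For $a,b\in\mathbb{R}^n$, $a\succ_k b$ means $\sum_{i=1}^n f(a_i)\ge\sum_{i=1}^n f(b_i)$ for every $k$ times differentiable $f:\mathbb{R}\to\mathbb{R}$ with $f^{(k)}\ge 0$. *)

theory Defs
  imports "HOL-Analysis.Analysis"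
begin

text \<open>Points of R^n are represented as functions nat => real supported on {0..<n}.\<close>

definition k_times_differentiable :: "nat \<Rightarrow> (real \<Rightarrow> real) \<Rightarrow> bool" where
  "k_times_differentiable k f \<longleftrightarrow>
     (\<forall>j<k. \<forall>x. ((deriv ^^ j) f has_real_derivative (deriv ^^ (Suc j)) f x) (at x))"

definition majorizes :: "nat \<Rightarrow> nat \<Rightarrow> (nat \<Rightarrow> real) \<Rightarrow> (nat \<Rightarrow> real) \<Rightarrow> bool" where
  "majorizes n k a b \<longleftrightarrow>
     (\<forall>f. k_times_differentiable k f \<and> (\<forall>x. (deriv ^^ k) f x \<ge> 0) \<longrightarrow>
        (\<Sum>i<n. f (a i)) \<ge> (\<Sum>i<n. f (b i)))"

definition S_set :: "nat \<Rightarrow> nat \<Rightarrow> (nat \<Rightarrow> real) \<Rightarrow> (nat \<Rightarrow> real) set" where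
  "S_set n k s = {x. (\<forall>i\<ge>n. x i = 0) \<and> (\<forall>i j. i \<le> j \<and> j < n \<longrightarrow> x i \<ge> x j) \<and>
                     (\<forall>j\<in>{1..k-1}. (\<Sum>i<n. x i ^ j) = s j)}"

end

theory Submission
  imports Defs
begin

text \<open>
  Two tuples with equal power sums of exponents below \<open>k\<close> whose difference sequence
  \<open>y i - x i\<close> has fewer than \<open>k - 1\<close> sign changes coincide: integrate the polynomial that changes
  sign exactly where the sequence does. For \<open>k + 1\<close> points this leaves \<open>k - 1\<close> or \<open>k\<close> changes, and
  which of the two occurs can be read off from the first and the last coordinates. With exactly
  \<open>k - 1\<close> changes, interpolating \<open>f'\<close> at the \<open>k - 1\<close> points of sign change (by a polynomial of degree
  below \<open>k - 1\<close>) shows that \<open>y\<close> majorizes \<open>x\<close>. Hence majorization is the closed order that compares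
  only the first and the last coordinates.

  This order is dense on the compact set \<open>S_k\<close>: if \<open>x < y\<close>, some index \<open>m\<close> can be dropped such that
  the remaining \<open>k\<close> differences strictly alternate in sign. Keeping the coordinate \<open>x m\<close> and replacing
  the product of \<open>t - x i\<close> over \<open>i \<noteq> m\<close> by itself minus a small constant, which still has \<open>k\<close> real roots
  by the intermediate value theorem and the same power sums by Newton's identities, produces a point
  strictly between \<open>x\<close> and \<open>y\<close>. A maximal chain between \<open>b\<close> and \<open>a\<close> is therefore compact without gaps,
  and is mapped homeomorphically onto an interval by a combination of the first and last coordinates.
\<close>

section \<open>Power sums and interpolation\<close>

text \<open>With \<open>q w i\<close> the product \<open>P w\<close> without its factor at
  \<open>w i\<close>, the sum of \<open>w i ^ j\<close> times \<open>q w i\<close> over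
  \<open>i\<close> links coefficients and power sums: for \<open>j = 0\<close> it is the derivative
  of \<open>P w\<close>, and its top coefficient is the \<open>j\<close>-th power sum.\<close>

lemma power_sums_eqI:
  fixes u v :: "nat \<Rightarrow> real"
  assumes eq: "\<And>l. coeff (\<Prod>i<k. [:- u i, 1:]) (Suc l) = coeff (\<Prod>i<k. [:- v i, 1:]) (Suc l)"
    and "j < k"
  shows "(\<Sum>i<k. u i ^ j) = (\<Sum>i<k. v i ^ j)"
proof -
  define P :: "(nat \<Rightarrow> real) \<Rightarrow> real poly" where "P w = (\<Prod>i<k. [:- w i, 1:])" for w
  define q :: "(nat \<Rightarrow> real) \<Rightarrow> nat \<Rightarrow> real poly"
    where "q w i = (\<Prod>l\<in>{..<k} - {i}. [:- w l, 1:])" for w i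
  \<comment> \<open>The recursion \<open>step\<close> below is a form of Newton's identities; for exponents below \<open>k\<close> the
    constant coefficient of \<open>P w\<close> never enters.\<close>
  define T where "T w j l = (\<Sum>i<k. w i ^ j * coeff (q w i) l)" for w j l
  have Pq: "P w = [:- w i, 1:] * q w i" if "i < k" for w i
    using that unfolding P_def q_def by (subst prod.remove[of _ i]) auto
  have coeffP: "coeff (P w) (Suc l) = coeff (q w i) l - w i * coeff (q w i) (Suc l)"
    if "i < k" for w i l
    using Pq[OF that, of w] by simp
  have step: "T w (Suc j) (Suc l) = T w j l - (\<Sum>i<k. w i ^ j) * coeff (P w) (Suc l)" for w j l
  proof -
    have "T w (Suc j) (Suc l) = (\<Sum>i<k. w i ^ j * (coeff (q w i) l - coeff (P w) (Suc l)))"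
      unfolding T_def by (rule sum.cong) (auto simp: coeffP)
    then show ?thesis
      unfolding T_def by (simp add: algebra_simps sum_subtractf sum_distrib_left)
  qed
  have base: "T w 0 l = of_nat (Suc l) * coeff (P w) (Suc l)" for w l
  proof -
    have "pderiv (P w) = (\<Sum>i<k. q w i)"
      unfolding P_def q_def by (subst pderiv_prod) (simp add: pderiv_pCons)
    then have "coeff (pderiv (P w)) l = T w 0 l"
      by (simp add: T_def coeff_sum)
    then show ?thesis by (simp add: coeff_pderiv)
  qed
  have top: "T w j (k - 1) = (\<Sum>i<k. w i ^ j)" for w j
  proof -
    have "coeff (q w i) (k - 1) = 1" if "i < k" for i
    proof -
      have "degree (q w i) = k - 1"
        unfolding q_def using that by (subst degree_prod_eq_sum_degree) auto
      moreover have "lead_coeff (q w i) = 1"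
        unfolding q_def by (subst lead_coeff_prod) auto
      ultimately show ?thesis by simp
    qed
    then show ?thesis unfolding T_def by simp
  qed
  \<comment> \<open>The recursion turns agreement at indices from \<open>j\<close> on into agreement
    from \<open>Suc j\<close> on. While \<open>j < k\<close>, the top index \<open>k - 1\<close> is
    included and supplies the power sum for the next step.\<close>
  have main: "j < k \<Longrightarrow> (\<forall>l\<ge>j. T u j l = T v j l)" for j
  proof (induction j)
    case 0
    then show ?case using eq by (simp add: base P_def)
  next
    case (Suc j)
    then have IH: "\<forall>l\<ge>j. T u j l = T v j l" by simp
    then have ps: "(\<Sum>i<k. u i ^ j) = (\<Sum>i<k. v i ^ j)"
      using top[of u j] top[of v j] Suc.prems by simp
    show ?case
    proof (intro allI impI)
      fix l assume "Suc j \<le> l"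
      then obtain l' where l': "l = Suc l'" "j \<le> l'" by (cases l) auto
      show "T u (Suc j) l = T v (Suc j) l"
        unfolding l'(1) step using IH l'(2) ps eq by (simp add: P_def)
    qed
  qed
  show ?thesis using main[OF \<open>j < k\<close>] \<open>j < k\<close> top[of u j] top[of v j] by simp
qed

lemma antiderivative_poly:
  fixes q :: "real poly"
  obtains Q where "pderiv Q = q" "degree Q \<le> Suc (degree q)"
proof
  define Q where "Q = (\<Sum>i\<le>degree q. monom (coeff q i / real (Suc i)) (Suc i))"
  show "pderiv Q = q"
  proof (rule poly_eqI)
    fix l
    have "coeff Q (Suc l) = (\<Sum>i\<le>degree q. if i = l then coeff q i / real (Suc i) else 0)"
      unfolding Q_def coeff_sum by (rule sum.cong) auto
    also have "\<dots> = coeff q l / real (Suc l)"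
      by (cases "l \<le> degree q") (auto simp: sum.delta coeff_eq_0)
    finally show "coeff (pderiv Q) l = coeff q l" by (simp add: coeff_pderiv)
  qed
  show "degree Q \<le> Suc (degree q)"
    unfolding Q_def by (rule degree_sum_le) (auto intro: order.trans[OF degree_monom_le])
qed

lemma sum_poly_eq_of_power_sums:
  fixes x y :: "nat \<Rightarrow> real" and Q :: "real poly"
  assumes ps: "\<And>j. j \<in> {1..k - 1} \<Longrightarrow> (\<Sum>i<n. x i ^ j) = (\<Sum>i<n. y i ^ j)"
    and "degree Q < k"
  shows "(\<Sum>i<n. poly Q (x i)) = (\<Sum>i<n. poly Q (y i))"
proof -
  have *: "(\<Sum>i<n. poly Q (z i)) = (\<Sum>j\<le>degree Q. coeff Q j * (\<Sum>i<n. z i ^ j))" for z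
    unfolding poly_altdef by (subst sum.swap) (simp add: sum_distrib_left)
  have "(\<Sum>i<n. x i ^ j) = (\<Sum>i<n. y i ^ j)" if "j \<le> degree Q" for j
    using that ps[of j] \<open>degree Q < k\<close> by (cases "j = 0") auto
  then show ?thesis unfolding * by (intro sum.cong) auto
qed

text \<open>An antiderivative \<open>H\<close> of \<open>h\<close> does not decrease from
  \<open>x i\<close> to \<open>y i\<close> for any \<open>i\<close>, while the two sums of its
  values agree because its degree is below \<open>k\<close>. So \<open>H\<close> is constant between
  \<open>x i\<close> and \<open>y i\<close>; were these distinct, \<open>h\<close> would vanish
  identically.\<close>

lemma eq_of_power_sums_of_sign:
  fixes x y :: "nat \<Rightarrow> real" and h :: "real poly"
  assumes ps: "\<And>j. j \<in> {1..k - 1} \<Longrightarrow> (\<Sum>i<n. x i ^ j) = (\<Sum>i<n. y i ^ j)"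
    and h: "h \<noteq> 0" "Suc (degree h) < k"
    and sgn: "\<And>i t. \<lbrakk>i < n; min (x i) (y i) < t; t < max (x i) (y i)\<rbrakk> \<Longrightarrow> (y i - x i) * poly h t \<ge> 0"
    and "i < n"
  shows "x i = y i"
proof (rule ccontr)
  assume ne: "x i \<noteq> y i"
  obtain H where H: "pderiv H = h" "degree H \<le> Suc (degree h)"
    by (rule antiderivative_poly)
  have inc: "poly H (x l) \<le> poly H t \<and> poly H t \<le> poly H (y l)"
    if "l < n" "x l < y l" "x l \<le> t" "t \<le> y l" for l t
  proof -
    have "poly H a \<le> poly H b" if "a \<le> b" "x l \<le> a" "b \<le> y l" for a b
    proof (rule DERIV_nonneg_imp_increasing_open[OF \<open>a \<le> b\<close>])
      fix c assume "a < c" "c < b"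
      then have "poly h c \<ge> 0"
        using sgn[OF \<open>l < n\<close>, of c] \<open>x l < y l\<close> that by (auto simp: zero_le_mult_iff)
      then show "\<exists>z. (poly H has_real_derivative z) (at c) \<and> 0 \<le> z"
        using poly_DERIV[of H c] H(1) by auto
    qed (auto intro!: continuous_intros)
    then show ?thesis using that by auto
  qed
  have dec: "poly H (x l) \<le> poly H t \<and> poly H t \<le> poly H (y l)"
    if "l < n" "y l < x l" "y l \<le> t" "t \<le> x l" for l t
  proof -
    have "poly H b \<le> poly H a" if "a \<le> b" "y l \<le> a" "b \<le> x l" for a b
    proof (rule DERIV_nonpos_imp_decreasing_open[OF \<open>a \<le> b\<close>])
      fix c assume "a < c" "c < b"
      then have "poly h c \<le> 0"
        using sgn[OF \<open>l < n\<close>, of c] \<open>y l < x l\<close> that by (auto simp: zero_le_mult_iff)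
      then show "\<exists>z. (poly H has_real_derivative z) (at c) \<and> z \<le> 0"
        using poly_DERIV[of H c] H(1) by auto
    qed (auto intro!: continuous_intros)
    then show ?thesis using that by auto
  qed
  have le: "poly H (x l) \<le> poly H (y l)" if "l < n" for l
    using inc[OF that, of "x l"] dec[OF that, of "x l"] by (cases "x l" "y l" rule: linorder_cases) auto
  have "(\<Sum>l<n. poly H (y l) - poly H (x l)) = 0"
    using sum_poly_eq_of_power_sums[where Q = H and k = k, OF ps] H(2) h(2) by (simp add: sum_subtractf)
  then have eq: "poly H (y i) = poly H (x i)"
    using le \<open>i < n\<close> by (subst (asm) sum_nonneg_eq_0_iff) auto
  define m M where "m = min (x i) (y i)" and "M = max (x i) (y i)"
  have "m < M" using ne unfolding m_def M_def by auto
  have const: "poly H t = poly H (x i)" if "m \<le> t" "t \<le> M" for t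
  proof -
    have "poly H (x i) \<le> poly H t \<and> poly H t \<le> poly H (y i)"
      using inc[OF \<open>i < n\<close>, of t] dec[OF \<open>i < n\<close>, of t] ne that
      unfolding m_def M_def by (cases "x i < y i") auto
    then show ?thesis using eq by linarith
  qed
  have "poly (H - [:poly H (x i):]) t = 0" if "t \<in> {m..M}" for t
    using const[of t] that by simp
  then have "{m..M} \<subseteq> {t. poly (H - [:poly H (x i):]) t = 0}"
    by blast
  moreover have "infinite {m..M}"
    using \<open>m < M\<close> by (rule infinite_Icc)
  ultimately have "H - [:poly H (x i):] = 0"
    using poly_roots_finite finite_subset by blast
  then have "pderiv H = pderiv [:poly H (x i):]" by simp
  then show False using H(1) h(1) by (simp add: pderiv_pCons)
qed

section \<open>Interpolation and iterated use of Rolle's theorem\<close>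

lemma lagrange_interpolation:
  fixes g :: "real \<Rightarrow> real"
  assumes "finite Z"
  obtains q where "degree q \<le> card Z - 1" "\<And>z. z \<in> Z \<Longrightarrow> poly q z = g z"
proof -
  from assms have "\<exists>q. degree q \<le> card Z - 1 \<and> (\<forall>z\<in>Z. poly q z = g z)"
  proof (induction Z)
    case empty
    then show ?case by (intro exI[of _ 0]) auto
  next
    case (insert z Z)
    then obtain q where q: "degree q \<le> card Z - 1" "\<forall>z\<in>Z. poly q z = g z" by auto
    define w where "w = (\<Prod>a\<in>Z. [:- a, 1:])"
    have deg: "degree w = card Z"
      unfolding w_def by (subst degree_prod_eq_sum_degree) auto
    have w0: "poly w a = 0" if "a \<in> Z" for a
      using that \<open>finite Z\<close> unfolding w_def poly_prod by (intro prod_zero) auto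
    have wz: "poly w z \<noteq> 0"
      using insert unfolding w_def poly_prod by auto
    define q' where "q' = q + smult ((g z - poly q z) / poly w z) w"
    have "degree q' \<le> card (insert z Z) - 1"
      unfolding q'_def using insert q(1) deg
      by (intro degree_add_le order.trans[OF degree_smult_le]) auto
    moreover have "\<forall>a\<in>insert z Z. poly q' a = g a"
      using q(2) w0 wz unfolding q'_def by auto
    ultimately show ?case by blast
  qed
  then show ?thesis using that by blast
qed

text \<open>The bound by \<open>Max Z\<close> carries the induction, which adds points from left to
  right: the zero found between the old maximum and the new point exceeds all earlier ones and is
  therefore new.\<close>

lemma rolle_finite:
  fixes f f' :: "real \<Rightarrow> real"
  assumes "finite Z" "Z \<noteq> {}" and zero: "\<And>z. z \<in> Z \<Longrightarrow> f z = 0"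
    and der: "\<And>t. (f has_real_derivative f' t) (at t)"
  shows "\<exists>Z'. finite Z' \<and> card Z' = card Z - 1 \<and> (\<forall>z\<in>Z'. f' z = 0 \<and> z < Max Z)"
  using assms(1,2) zero
proof (induction Z rule: finite_linorder_max_induct)
  case empty
  then show ?case by simp
next
  case (insert b Z)
  show ?case
  proof (cases "Z = {}")
    case True
    then show ?thesis by (intro exI[of _ "{}"]) auto
  next
    case False
    with insert obtain Z' where Z': "finite Z'" "card Z' = card Z - 1"
      "\<forall>z\<in>Z'. f' z = 0 \<and> z < Max Z" by auto
    define m where "m = Max Z"
    have m: "m \<in> Z" using False insert(1) unfolding m_def by auto
    then have "m < b" using insert by auto
    have cont: "continuous_on {m..b} f"
      using der by (auto intro!: continuous_at_imp_continuous_on DERIV_isCont)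
    have "\<exists>c. m < c \<and> c < b \<and> (f has_real_derivative 0) (at c)"
      using \<open>m < b\<close> insert.prems(2)[of m] insert.prems(2)[of b] m cont der
      by (intro Rolle) (auto simp: real_differentiable_def)
    then obtain c where c: "m < c" "c < b" "f' c = 0"
      using der DERIV_unique by metis
    have "c \<notin> Z'" using Z'(3) c(1) unfolding m_def by auto
    then have card': "card (insert c Z') = card (insert b Z) - 1"
      using Z' insert(1,2) False m by (auto simp: card_gt_0_iff card_insert_if)
    have "Max (insert b Z) = b"
      using insert(1,2) by (intro Max_eqI) (auto intro: less_imp_le)
    then show ?thesis using Z' c card' \<open>m < b\<close>
      by (intro exI[of _ "insert c Z'"]) (auto simp: m_def[symmetric] intro: less_trans)
  qed
qed

lemma rolle_iterated:
  fixes D :: "nat \<Rightarrow> real \<Rightarrow> real"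
  assumes "\<And>j t. j < N \<Longrightarrow> (D j has_real_derivative D (Suc j) t) (at t)"
    and "finite Z" "card Z = Suc N" "\<And>z. z \<in> Z \<Longrightarrow> D 0 z = 0"
  obtains c where "D N c = 0"
proof -
  have "\<exists>Z'. finite Z' \<and> card Z' = Suc (N - j) \<and> (\<forall>z\<in>Z'. D j z = 0)" if "j \<le> N" for j
    using that
  proof (induction j)
    case 0
    then show ?case using assms by auto
  next
    case (Suc j)
    then obtain Z' where Z': "finite Z'" "card Z' = Suc (N - j)" "\<forall>z\<in>Z'. D j z = 0" by auto
    have "Z' \<noteq> {}" using Z'(2) by auto
    then obtain Z'' where "finite Z''" "card Z'' = card Z' - 1" "\<forall>z\<in>Z''. D (Suc j) z = 0"
      using rolle_finite[of Z' "D j" "D (Suc j)"] Z' assms(1)[of j] Suc.prems by auto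
    then show ?case using Z'(2) Suc.prems by (intro exI[of _ Z'']) auto
  qed
  from this[of N] obtain Z' where "card Z' = 1" "\<forall>z\<in>Z'. D N z = 0" by auto
  then show ?thesis using that by (auto simp: card_1_singleton_iff)
qed

section \<open>Sign changes and majorization\<close>

text \<open>Zero entries never count as a change: they are given the sign of the preceding block, and the
  initial block has sign \<open>+\<close>. The results below therefore assume a nonnegative first entry.\<close>

fun alternations :: "(nat \<Rightarrow> real) \<Rightarrow> nat \<Rightarrow> nat" where
  "alternations d 0 = 0"
| "alternations d (Suc i) =
     (if (-1) ^ alternations d i * d (Suc i) \<ge> 0 then alternations d i else Suc (alternations d i))"

lemma alternations_sign: "d 0 \<ge> 0 \<Longrightarrow> (-1) ^ alternations d i * d i \<ge> 0"
  by (induction i) auto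

lemma alternations_mono: "i \<le> j \<Longrightarrow> alternations d i \<le> alternations d j"
  by (rule lift_Suc_mono_le) auto

lemma alternations_le: "alternations d i \<le> i"
  by (induction i) auto

lemma alternations_jump:
  "j < alternations d N \<Longrightarrow>
     \<exists>i<N. alternations d i = j \<and> alternations d (Suc i) = Suc j \<and> d (Suc i) \<noteq> 0"
proof (induction N)
  case (Suc N)
  show ?case
  proof (cases "j < alternations d N")
    case True
    with Suc.IH show ?thesis by (auto simp del: alternations.simps intro: less_SucI)
  next
    case False
    with Suc.prems show ?thesis
      by (intro exI[of _ N]) (auto split: if_splits)
  qed
qed simp

text \<open>Once the counter of \<open>d\<close> is ahead by exactly one, the two sign tests for the
  next entry concern the same number, so from there on both counters advance together.\<close>

lemma alternations_uminus:
  assumes "alternations d i = Suc (alternations (\<lambda>l. - d l) i)" "i \<le> j"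
  shows "alternations d j = Suc (alternations (\<lambda>l. - d l) j)"
  using assms(2) by (induction rule: dec_induct) (use assms(1) in auto)

text \<open>The thresholds transfer the sign changes to the real line: \<open>\<zeta> j\<close> lies
  between the segments from \<open>x i\<close> to \<open>y i\<close> before change \<open>j\<close>
  and those after it. The differences on the two sides of a change have opposite signs, so
  sortedness of \<open>x\<close> and \<open>y\<close> keeps the neighbouring segments apart.\<close>

lemma separators:
  fixes x y :: "nat \<Rightarrow> real"
  defines "d \<equiv> \<lambda>i. y i - x i"
  assumes x: "\<And>i j. i \<le> j \<Longrightarrow> j \<le> N \<Longrightarrow> x j \<le> x i"
    and y: "\<And>i j. i \<le> j \<Longrightarrow> j \<le> N \<Longrightarrow> y j \<le> y i"
    and "x 0 \<le> y 0"
  obtains \<zeta> where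
    "\<And>i j. \<lbrakk>i \<le> N; j < alternations d i\<rbrakk> \<Longrightarrow> max (x i) (y i) \<le> \<zeta> j"
    "\<And>i j. \<lbrakk>i \<le> N; alternations d i \<le> j; j < alternations d N\<rbrakk> \<Longrightarrow> \<zeta> j \<le> min (x i) (y i)"
    "inj_on \<zeta> {..<alternations d N}"
proof -
  have "d 0 \<ge> 0" using \<open>x 0 \<le> y 0\<close> by (simp add: d_def)
  note sgn = alternations_sign[of d, OF this]
  have "\<exists>i. i < N \<and> alternations d i = j \<and> alternations d (Suc i) = Suc j \<and> d (Suc i) \<noteq> 0"
    if "j < alternations d N" for j
    using alternations_jump[OF that] by blast
  then obtain e where e: "\<And>j. j < alternations d N \<Longrightarrow> e j < N \<and> alternations d (e j) = j \<and>
      alternations d (Suc (e j)) = Suc j \<and> d (Suc (e j)) \<noteq> 0"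
    by metis
  \<comment> \<open>\<open>e j\<close> is the last index before change \<open>j\<close>; the lower
    end of its segment serves as threshold.\<close>
  define \<zeta> where "\<zeta> j = min (x (e j)) (y (e j))" for j
  have up: "max (x i) (y i) \<le> \<zeta> j" if "i \<le> N" "j < alternations d i" for i j
  proof -
    have j: "j < alternations d N"
      using that alternations_mono[of i N d] by simp
    note ej = e[OF j]
    have "Suc (e j) \<le> i"
      using that ej alternations_mono[of i "e j" d] by (cases "i \<le> e j") auto
    then have 1: "max (x i) (y i) \<le> max (x (Suc (e j))) (y (Suc (e j)))"
      using x[of "Suc (e j)" i] y[of "Suc (e j)" i] that by auto
    have "(-1) ^ j * d (e j) \<ge> 0" "(-1) ^ Suc j * d (Suc (e j)) \<ge> 0"
      using sgn[of "e j"] sgn[of "Suc (e j)"] ej by metis+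
    moreover have "x (Suc (e j)) \<le> x (e j)" "y (Suc (e j)) \<le> y (e j)"
      using x y ej by auto
    ultimately have "max (x (Suc (e j))) (y (Suc (e j))) \<le> \<zeta> j"
      unfolding \<zeta>_def d_def by (cases "even j") auto
    with 1 show ?thesis by linarith
  qed
  have down: "\<zeta> j \<le> min (x i) (y i)"
    if "i \<le> N" "alternations d i \<le> j" "j < alternations d N" for i j
  proof -
    note ej = e[OF that(3)]
    have "i \<le> e j"
      using that ej alternations_mono[of "Suc (e j)" i d] by (cases "Suc (e j) \<le> i") auto
    then show ?thesis
      using x[of i "e j"] y[of i "e j"] ej unfolding \<zeta>_def by auto
  qed
  \<comment> \<open>The segment at the index right after a change lies between the two thresholds.
    An entry counted as a change is nonzero, so this segment has positive length and the inequality
    is strict.\<close>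
  have less: "\<zeta> j < \<zeta> i" if "i < j" "j < alternations d N" for i j
  proof -
    obtain j' where j': "j = Suc j'" using \<open>i < j\<close> by (cases j) auto
    define l where "l = Suc (e j')"
    have l: "l \<le> N" "alternations d l = j" "x l \<noteq> y l"
      using e[of j'] j' that by (auto simp: l_def d_def simp del: alternations.simps)
    show ?thesis using up[of l i] down[of l j] l that by auto
  qed
  have "inj_on \<zeta> {..<alternations d N}"
    by (rule linorder_inj_onI) (use less in force)+
  then show ?thesis using that up down by blast
qed

lemma sign_separator_prod:
  fixes \<zeta> :: "nat \<Rightarrow> real"
  assumes "m \<le> M" "\<And>j. j < m \<Longrightarrow> t \<le> \<zeta> j" "\<And>j. \<lbrakk>m \<le> j; j < M\<rbrakk> \<Longrightarrow> \<zeta> j \<le> t"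
  shows "(-1) ^ m * poly (\<Prod>j<M. [:- \<zeta> j, 1:]) t \<ge> 0"
proof -
  have "{..<M} = {..<m} \<union> {m..<M}" "{..<m} \<inter> {m..<M} = {}" using \<open>m \<le> M\<close> by auto
  then have "poly (\<Prod>j<M. [:- \<zeta> j, 1:]) t = (\<Prod>j<m. t - \<zeta> j) * (\<Prod>j=m..<M. t - \<zeta> j)"
    by (simp add: poly_prod prod.union_disjoint)
  moreover have "(-1) ^ m * (\<Prod>j<m. t - \<zeta> j) = (\<Prod>j<m. \<zeta> j - t)"
    using prod.distrib[of "\<lambda>_. -1" "\<lambda>j. t - \<zeta> j" "{..<m}"] by simp
  ultimately have "(-1) ^ m * poly (\<Prod>j<M. [:- \<zeta> j, 1:]) t =
      (\<Prod>j<m. \<zeta> j - t) * (\<Prod>j=m..<M. t - \<zeta> j)"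
    by (simp add: mult.assoc[symmetric])
  also have "\<dots> \<ge> 0"
    using assms by (intro mult_nonneg_nonneg prod_nonneg) auto
  finally show ?thesis .
qed

text \<open>The polynomial with roots at the thresholds has the number of sign changes as its degree
  and, between \<open>x i\<close> and \<open>y i\<close>, weakly the sign of
  \<open>y i - x i\<close>, so \<open>eq_of_power_sums_of_sign\<close> applies.\<close>

lemma eq_of_few_alternations:
  fixes x y :: "nat \<Rightarrow> real"
  assumes x: "\<And>i j. i \<le> j \<Longrightarrow> j \<le> N \<Longrightarrow> x j \<le> x i"
    and y: "\<And>i j. i \<le> j \<Longrightarrow> j \<le> N \<Longrightarrow> y j \<le> y i"
    and "x 0 \<le> y 0"
    and ps: "\<And>j. j \<in> {1..k - 1} \<Longrightarrow> (\<Sum>i\<le>N. x i ^ j) = (\<Sum>i\<le>N. y i ^ j)"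
    and few: "Suc (alternations (\<lambda>i. y i - x i) N) < k"
    and "i \<le> N"
  shows "x i = y i"
proof -
  define d where "d = (\<lambda>i. y i - x i)"
  define A where "A = alternations d"
  obtain \<zeta> where \<zeta>:
    "\<And>i j. \<lbrakk>i \<le> N; j < A i\<rbrakk> \<Longrightarrow> max (x i) (y i) \<le> \<zeta> j"
    "\<And>i j. \<lbrakk>i \<le> N; A i \<le> j; j < A N\<rbrakk> \<Longrightarrow> \<zeta> j \<le> min (x i) (y i)"
    "inj_on \<zeta> {..<A N}"
  proof (rule separators[where N = N and x = x and y = y, folded d_def A_def], goal_cases)
    case (4 \<zeta>)
    show ?thesis by (rule that[OF 4(2-4)])
  qed (rule x y \<open>x 0 \<le> y 0\<close>; assumption)+
  define h where "h = (\<Prod>j<A N. [:- \<zeta> j, 1:])"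
  have sgn: "(y i - x i) * poly h t \<ge> 0"
    if "i < Suc N" "min (x i) (y i) < t" "t < max (x i) (y i)" for i t
  proof -
    have "(-1) ^ A i * poly h t \<ge> 0"
      unfolding h_def
    proof (rule sign_separator_prod)
      show "A i \<le> A N" using that alternations_mono[of i N] by (simp add: A_def)
    next
      fix j assume "j < A i"
      then show "t \<le> \<zeta> j" using \<zeta>(1)[of i j] that by linarith
    next
      fix j assume "A i \<le> j" "j < A N"
      then show "\<zeta> j \<le> t" using \<zeta>(2)[of i j] that by linarith
    qed
    moreover have "(-1) ^ A i * (y i - x i) \<ge> 0"
      using alternations_sign[of d i] \<open>x 0 \<le> y 0\<close> by (simp add: A_def d_def)
    ultimately show ?thesis by (cases "even (A i)") (auto simp: mult_nonpos_nonpos)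
  qed
  have "degree h = A N"
    unfolding h_def by (subst degree_prod_eq_sum_degree) auto
  then have "Suc (degree h) < k" using few by (simp add: A_def d_def)
  moreover have "h \<noteq> 0" unfolding h_def by auto
  ultimately show ?thesis
    using eq_of_power_sums_of_sign[where k = k and n = "Suc N" and h = h and i = i and x = x and y = y]
      sgn ps \<open>i \<le> N\<close> by (simp add: lessThan_Suc_atMost less_Suc_eq_le)
qed

text \<open>By the mean value form of the interpolation error, \<open>deriv f t - poly q t\<close>
  is the node polynomial at \<open>t\<close> times \<open>(deriv ^^ k) f c / fact (k - 1)\<close>
  for some \<open>c\<close>. The product is thus a square times a nonnegative number.\<close>

lemma interpolation_sign:
  fixes f :: "real \<Rightarrow> real"
  assumes f: "k_times_differentiable k f" "\<And>t. (deriv ^^ k) f t \<ge> 0"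
    and Z: "finite Z" "card Z = k - 1" and "k \<ge> 2"
  obtains q where "degree q < k - 1" "\<And>z. z \<in> Z \<Longrightarrow> poly q z = deriv f z"
    "\<And>t. (deriv f t - poly q t) * poly (\<Prod>z\<in>Z. [:- z, 1:]) t \<ge> 0"
proof -
  define w where "w = (\<Prod>z\<in>Z. [:- z, 1:])"
  have degw: "degree w = k - 1"
    unfolding w_def using Z by (subst degree_prod_eq_sum_degree) auto
  have lw: "lead_coeff w = 1"
    unfolding w_def by (subst lead_coeff_prod) auto
  obtain q where q: "degree q \<le> card Z - 1" "\<And>z. z \<in> Z \<Longrightarrow> poly q z = deriv f z"
    using lagrange_interpolation[OF Z(1)] by metis
  have degq: "degree q < k - 1" using q(1) Z(2) \<open>k \<ge> 2\<close> by simp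
  have "(deriv f t - poly q t) * poly w t \<ge> 0" for t
  proof (cases "poly w t = 0")
    case False
    \<comment> \<open>With this factor \<open>r\<close> also interpolates \<open>deriv f\<close> at
      \<open>t\<close>, which gives \<open>D 0\<close> one zero beyond the \<open>k - 1\<close>
      nodes and forces a zero of \<open>D (k - 1)\<close>.\<close>
    define \<mu> where "\<mu> = (deriv f t - poly q t) / poly w t"
    define r where "r = q + smult \<mu> w"
    define D where "D j u = (deriv ^^ Suc j) f u - poly ((pderiv ^^ j) r) u" for j u
    have tZ: "t \<notin> Z" using False Z(1) unfolding w_def poly_prod by auto
    have "D 0 z = 0" if "z \<in> insert t Z" for z
    proof (cases "z = t")
      case True
      then show ?thesis using False by (simp add: D_def r_def \<mu>_def)
    next
      case False
      then have "poly w z = 0" "z \<in> Z"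
        using that Z(1) unfolding w_def poly_prod by (auto intro!: prod_zero)
      then show ?thesis using q(2) by (simp add: D_def r_def)
    qed
    moreover have "(D j has_real_derivative D (Suc j) u) (at u)" if "j < k - 1" for j u
    proof -
      have "((deriv ^^ Suc j) f has_real_derivative (deriv ^^ Suc (Suc j)) f u) (at u)"
        using f(1) that unfolding k_times_differentiable_def
        by (metis Suc_diff_1 Suc_less_eq less_nat_zero_code not_gr_zero diff_0_eq_0)
      moreover have "(poly ((pderiv ^^ j) r) has_real_derivative poly ((pderiv ^^ Suc j) r) u) (at u)"
        using poly_DERIV[of "(pderiv ^^ j) r" u] by simp
      ultimately show ?thesis unfolding D_def by (rule DERIV_diff)
    qed
    moreover have "finite (insert t Z)" "card (insert t Z) = Suc (k - 1)"
      using Z tZ by auto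
    ultimately obtain c where c: "D (k - 1) c = 0"
      using rolle_iterated[of "k - 1" D "insert t Z"] by blast
    have "degree r \<le> k - 1" "coeff r (k - 1) = \<mu>"
      using degq degw lw unfolding r_def
      by (auto intro!: degree_add_le order.trans[OF degree_smult_le] simp: coeff_eq_0)
    then have "(pderiv ^^ (k - 1)) r = [:fact (k - 1) * \<mu>:]"
      by (intro poly_eqI) (auto simp: coeff_higher_pderiv coeff_pCons pochhammer_fact coeff_eq_0 split: nat.splits)
    then have "(deriv ^^ k) f c = fact (k - 1) * \<mu>"
      using c \<open>k \<ge> 2\<close> unfolding D_def by (simp del: funpow.simps add: Suc_diff_1)
    then have "fact (k - 1) * \<mu> \<ge> 0" using f(2)[of c] by simp
    then have "\<mu> \<ge> 0"
      using fact_gt_zero[of "k - 1", where 'a = real] by (meson mult_pos_neg not_le)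
    then have "\<mu> * (poly w t)\<^sup>2 \<ge> 0" by simp
    then show ?thesis using False by (simp add: \<mu>_def power2_eq_square)
  qed simp
  then show ?thesis using that degq q(2) unfolding w_def by blast
qed

text \<open>Let \<open>Q\<close> be an antiderivative of the interpolant of \<open>deriv f\<close>
  at the thresholds. Its degree is below \<open>k\<close>, so it contributes equally to both sums.
  The derivative of \<open>f - Q\<close> has weakly the sign of \<open>y i - x i\<close> along the
  whole segment, so \<open>f - Q\<close> does not decrease from \<open>x i\<close> to
  \<open>y i\<close>.\<close>

lemma majorizes_of_alternations:
  fixes x y :: "nat \<Rightarrow> real"
  assumes x: "\<And>i j. i \<le> j \<Longrightarrow> j \<le> N \<Longrightarrow> x j \<le> x i"
    and y: "\<And>i j. i \<le> j \<Longrightarrow> j \<le> N \<Longrightarrow> y j \<le> y i"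
    and "x 0 \<le> y 0"
    and ps: "\<And>j. j \<in> {1..k - 1} \<Longrightarrow> (\<Sum>i\<le>N. x i ^ j) = (\<Sum>i\<le>N. y i ^ j)"
    and alt: "alternations (\<lambda>i. y i - x i) N = k - 1" and "k \<ge> 2"
  shows "majorizes (Suc N) k y x"
  unfolding majorizes_def
proof (intro allI impI, elim conjE)
  fix f assume f: "k_times_differentiable k f" "\<forall>t. (deriv ^^ k) f t \<ge> 0"
  define d where "d = (\<lambda>i. y i - x i)"
  define A where "A = alternations d"
  have AN: "A N = k - 1" using alt by (simp add: A_def d_def)
  obtain \<zeta> where \<zeta>:
    "\<And>i j. \<lbrakk>i \<le> N; j < A i\<rbrakk> \<Longrightarrow> max (x i) (y i) \<le> \<zeta> j"
    "\<And>i j. \<lbrakk>i \<le> N; A i \<le> j; j < A N\<rbrakk> \<Longrightarrow> \<zeta> j \<le> min (x i) (y i)"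
    and inj: "inj_on \<zeta> {..<A N}"
  proof (rule separators[where N = N and x = x and y = y, folded d_def A_def], goal_cases)
    case (4 \<zeta>)
    show ?thesis by (rule that[OF 4(2-4)])
  qed (rule x y \<open>x 0 \<le> y 0\<close>; assumption)+
  have card: "card (\<zeta> ` {..<A N}) = k - 1" using inj by (simp add: card_image AN)
  obtain q where q: "degree q < k - 1" "\<And>z. z \<in> \<zeta> ` {..<A N} \<Longrightarrow> poly q z = deriv f z"
    "\<And>t. (deriv f t - poly q t) * poly (\<Prod>z\<in>\<zeta> ` {..<A N}. [:- z, 1:]) t \<ge> 0"
    using interpolation_sign[OF f(1) _ _ card \<open>k \<ge> 2\<close>] f(2) by auto
  define h where "h = (\<Prod>j<A N. [:- \<zeta> j, 1:])"
  have "(\<Prod>z\<in>\<zeta> ` {..<A N}. [:- z, 1:]) = h"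
    unfolding h_def using inj by (simp add: prod.reindex)
  with q(3) have qh: "(deriv f t - poly q t) * poly h t \<ge> 0" for t by simp
  obtain Q where Q: "pderiv Q = q" "degree Q \<le> Suc (degree q)"
    by (rule antiderivative_poly)
  have der: "((\<lambda>u. f u - poly Q u) has_real_derivative deriv f t - poly q t) (at t)" for t
  proof -
    have "((deriv ^^ 0) f has_real_derivative (deriv ^^ Suc 0) f t) (at t)"
      using f(1) \<open>k \<ge> 2\<close> unfolding k_times_differentiable_def by (metis less_le_trans zero_less_numeral)
    then show ?thesis using poly_DERIV[of Q t] Q(1) by (auto intro!: DERIV_diff)
  qed
  have sgn: "(-1) ^ A i * (deriv f t - poly q t) \<ge> 0"
    if "i \<le> N" "min (x i) (y i) \<le> t" "t \<le> max (x i) (y i)" for i t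
  \<comment> \<open>Where \<open>h\<close> vanishes the product inequality says nothing, but there
    \<open>q\<close> agrees with \<open>deriv f\<close>.\<close>
  proof (cases "poly h t = 0")
    case True
    then have "t \<in> \<zeta> ` {..<A N}"
      unfolding h_def poly_prod by auto
    then show ?thesis using q(2) by simp
  next
    case False
    have "(-1) ^ A i * poly h t \<ge> 0"
      unfolding h_def
    proof (rule sign_separator_prod)
      show "A i \<le> A N" using that alternations_mono[of i N] by (simp add: A_def)
    next
      fix j assume "j < A i"
      then show "t \<le> \<zeta> j" using \<zeta>(1)[of i j] that by linarith
    next
      fix j assume "A i \<le> j" "j < A N"
      then show "\<zeta> j \<le> t" using \<zeta>(2)[of i j] that by linarith
    qed
    then show ?thesis
      using qh[of t] False by (cases "even (A i)") (auto simp: zero_le_mult_iff mult_le_0_iff)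
  qed
  have "f (y i) - poly Q (y i) \<ge> f (x i) - poly Q (x i)" if "i \<le> N" for i
  proof -
    have s: "(-1) ^ A i * (y i - x i) \<ge> 0"
      using alternations_sign[of d i] \<open>x 0 \<le> y 0\<close> by (simp add: A_def d_def)
    show ?thesis
    proof (cases "even (A i)")
      case True
      then have "x i \<le> y i" using s by simp
      then show ?thesis
      proof (rule DERIV_nonneg_imp_nondecreasing)
        fix t assume "x i \<le> t" "t \<le> y i"
        then have "deriv f t - poly q t \<ge> 0" using sgn[OF that, of t] True by simp
        then show "\<exists>D. ((\<lambda>u. f u - poly Q u) has_real_derivative D) (at t) \<and> 0 \<le> D"
          using der by blast
      qed
    next
      case False
      then have "y i \<le> x i" using s by simp
      then show ?thesis
      proof (rule DERIV_nonpos_imp_nonincreasing)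
        fix t assume "y i \<le> t" "t \<le> x i"
        then have "deriv f t - poly q t \<le> 0" using sgn[OF that, of t] False by simp
        then show "\<exists>D. ((\<lambda>u. f u - poly Q u) has_real_derivative D) (at t) \<and> D \<le> 0"
          using der by blast
      qed
    qed
  qed
  then have "(\<Sum>i\<le>N. f (y i) - poly Q (y i)) \<ge> (\<Sum>i\<le>N. f (x i) - poly Q (x i))"
    by (intro sum_mono) auto
  moreover have "(\<Sum>i<Suc N. poly Q (x i)) = (\<Sum>i<Suc N. poly Q (y i))"
    using Q(2) q(1) ps by (intro sum_poly_eq_of_power_sums[where k = k]) (auto simp: lessThan_Suc_atMost)
  ultimately show "(\<Sum>i<Suc N. f (x i)) \<le> (\<Sum>i<Suc N. f (y i))"
    by (simp add: sum_subtractf lessThan_Suc_atMost)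
qed

text \<open>On \<open>S_set (k + 1) k s\<close> this agrees with majorization of \<open>x\<close> by \<open>y\<close>, see
  \<open>majorizes_of_corner_le\<close> and \<open>corner_le_of_majorizes\<close>.\<close>

definition corner_le :: "nat \<Rightarrow> (nat \<Rightarrow> real) \<Rightarrow> (nat \<Rightarrow> real) \<Rightarrow> bool" where
  "corner_le k x y \<longleftrightarrow> x 0 \<le> y 0 \<and> (-1) ^ k * y k \<le> (-1) ^ k * x k"

text \<open>The sequence \<open>x \<circ> skip m\<close> is \<open>x\<close> with its \<open>m\<close>-th entry removed.\<close>

definition skip :: "nat \<Rightarrow> nat \<Rightarrow> nat" where
  "skip m i = (if i < m then i else Suc i)"

section \<open>Sign patterns of differences of points in \<open>S_set\<close>\<close>

lemma S_setD:
  assumes "x \<in> S_set (k + 1) k s"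
  shows "i \<le> j \<Longrightarrow> j \<le> k \<Longrightarrow> x j \<le> x i"
    and "j \<in> {1..k - 1} \<Longrightarrow> (\<Sum>i\<le>k. x i ^ j) = s j"
    and "i > k \<Longrightarrow> x i = 0"
  using assms by (auto simp: S_set_def lessThan_Suc_atMost)

lemma few_alternations_S_set:
  assumes "x \<in> S_set (k + 1) k s" "y \<in> S_set (k + 1) k s" "x 0 \<le> y 0"
    and "Suc (alternations (\<lambda>i. y i - x i) k) < k"
  shows "x = y"
proof
  fix i
  show "x i = y i"
  proof (cases "i \<le> k")
    case True
    show ?thesis
    proof (rule eq_of_few_alternations)
      show "Suc (alternations (\<lambda>i. y i - x i) k) < k" by fact
    qed (use S_setD[OF assms(1)] S_setD[OF assms(2)] assms(3) True in auto)
  next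
    case False
    then show ?thesis using S_setD(3)[OF assms(1)] S_setD(3)[OF assms(2)] by simp
  qed
qed

lemma alternations_diff_le: "i \<le> j \<Longrightarrow> alternations d j \<le> alternations d i + (j - i)"
  by (induction rule: dec_induct) auto

lemma alternations_corner_le:
  assumes x: "x \<in> S_set (k + 1) k s" and y: "y \<in> S_set (k + 1) k s"
    and le: "corner_le k x y" and "x \<noteq> y" and "k \<ge> 2"
  shows "alternations (\<lambda>i. y i - x i) k = k - 1"
proof -
  define d where "d = (\<lambda>i. y i - x i)"
  define A where "A = alternations d"
  have "k \<le> Suc (A k)"
    using few_alternations_S_set[OF x y] le \<open>x \<noteq> y\<close>
    unfolding corner_le_def A_def d_def by fastforce
  moreover have "A k \<le> k" unfolding A_def by (rule alternations_le)
  \<comment> \<open>With \<open>k\<close> changes the last difference would be nonzero with sign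
    \<open>(-1) ^ k\<close>, against the condition on the last coordinates.\<close>
  moreover have "A k \<noteq> k"
  proof
    assume "A k = k"
    moreover obtain l where l: "k = Suc l" using \<open>k \<ge> 2\<close> by (cases k) auto
    ultimately have "A l = l"
      using alternations_le[of d l] alternations_diff_le[of l k d] by (simp add: A_def)
    with \<open>A k = k\<close> have "(-1) ^ l * d k < 0"
      unfolding l A_def by (auto split: if_splits)
    then show False using le unfolding corner_le_def d_def l by (simp add: algebra_simps)
  qed
  ultimately show ?thesis by (simp add: A_def d_def)
qed

text \<open>With \<open>k - 1\<close> changes in \<open>k\<close> steps exactly one step brings no
  change, and a step with a change ends at a strictly signed difference. Dropping the index where
  the idle step ends leaves a strict alternation, unless the first difference is zero; then index 0
  is dropped instead.\<close>

lemma strict_alternation_skip: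
  assumes x: "x \<in> S_set (k + 1) k s" and y: "y \<in> S_set (k + 1) k s"
    and le: "corner_le k x y" and "x \<noteq> y" and "k \<ge> 2"
  obtains m where "m \<le> k" "\<And>i. i < k \<Longrightarrow> (-1) ^ i * (y (skip m i) - x (skip m i)) > 0"
proof -
  define d where "d = (\<lambda>i. y i - x i)"
  define A where "A = alternations d"
  have Ak: "A k = k - 1"
    using alternations_corner_le[OF assms] by (simp add: A_def d_def)
  have d0: "d 0 \<ge> 0" using le by (simp add: corner_le_def d_def)
  define m where "m = (LEAST i. A i < i)"
  have ex: "A k < k" using Ak \<open>k \<ge> 2\<close> by simp
  have Am: "A m < m" and "m \<le> k"
    using LeastI[of "\<lambda>i. A i < i", OF ex] Least_le[of "\<lambda>i. A i < i", OF ex] by (auto simp: m_def)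
  have before: "A i = i" if "i < m" for i
    using not_less_Least[of i "\<lambda>i. A i < i"] that alternations_le[of d i]
    by (auto simp: m_def A_def)
  have after: "A i = i - 1" if "m \<le> i" "i \<le> k" for i
  proof -
    have "A i \<le> A m + (i - m)" "A k \<le> A i + (k - i)"
      using that alternations_diff_le by (auto simp: A_def)
    then show ?thesis using Am Ak that by linarith
  qed
  have "m > 0" using Am by simp
  have strict: "(-1) ^ A i * d i > 0" if "0 < i" "i \<le> k" "i \<noteq> m" for i
  proof -
    obtain l where l: "i = Suc l" using \<open>0 < i\<close> by (cases i) auto
    have "A i = Suc (A l)"
    proof (cases "i < m")
      case True
      then show ?thesis using before[of i] before[of l] l by simp
    next
      case False
      then show ?thesis using after[of i] after[of l] that l \<open>m > 0\<close> by simp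
    qed
    then show ?thesis unfolding l A_def by (auto split: if_splits)
  qed
  show ?thesis
  proof (cases "d 0 = 0")
    case False
    have "(-1) ^ i * d (skip m i) > 0" if "i < k" for i
    proof (cases "i < m")
      case True
      then show ?thesis
        using strict[of i] before[of i] d0 False that by (cases "i = 0") (auto simp: skip_def)
    next
      case False
      then show ?thesis
        using strict[of "Suc i"] after[of "Suc i"] that by (auto simp: skip_def)
    qed
    then show ?thesis using that[of m] \<open>m \<le> k\<close> by (simp add: d_def)
  next
    case True
    \<comment> \<open>As the first difference is zero, \<open>x\<close> and \<open>y\<close> may be
      exchanged. So \<open>- d\<close> has at least \<open>k - 1\<close> changes too, and its count
      is never exactly one behind that of \<open>d\<close>. If \<open>d 1 \<le> 0\<close>, this
      would fail at index 1 or 2.\<close>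
    define B where "B = alternations (\<lambda>i. - d i)"
    have "k \<le> Suc (B k)"
      using few_alternations_S_set[OF y x] True \<open>x \<noteq> y\<close>
      unfolding B_def d_def by fastforce
    then have AB: "A i \<noteq> Suc (B i)" if "i \<le> k" for i
      using alternations_uminus[of d i k] that Ak \<open>k \<ge> 2\<close> unfolding A_def B_def by auto
    have "d 1 > 0"
    proof (rule ccontr)
      assume "\<not> d 1 > 0"
      then consider "d 1 < 0" | "d 1 = 0" by linarith
      then show False
      proof cases
        case 1
        then show False using AB[of 1] \<open>k \<ge> 2\<close> by (simp add: A_def B_def)
      next
        case 2
        then have "A 1 < 1" "B 1 = 0" by (auto simp: A_def B_def)
        then have "m = 1"
          using Least_le[of "\<lambda>i. A i < i" 1] \<open>m > 0\<close> unfolding m_def by simp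
        then have "A 2 = 1" "d 2 < 0"
          using after[of 2] strict[of 2] \<open>k \<ge> 2\<close> by auto
        then show False
          using AB[of 2] \<open>B 1 = 0\<close> \<open>k \<ge> 2\<close> by (simp add: B_def numeral_2_eq_2)
      qed
    qed
    then have "A 1 < 1" by (simp add: A_def)
    then have "m = 1"
      using Least_le[of "\<lambda>i. A i < i" 1] \<open>m > 0\<close> unfolding m_def by simp
    have "(-1) ^ i * d (skip 0 i) > 0" if "i < k" for i
      using strict[of "Suc i"] after[of "Suc i"] \<open>d 1 > 0\<close> \<open>m = 1\<close> that
      by (cases "i = 0") (auto simp: skip_def)
    then show ?thesis using that[of 0] by (simp add: d_def)
  qed
qed

text \<open>The alternation that remains after dropping one index still contains the first or the
  last index, where comparison in both directions forces a zero difference.\<close>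

lemma corner_le_antisym:
  assumes "x \<in> S_set (k + 1) k s" "y \<in> S_set (k + 1) k s" "k \<ge> 2"
    and "corner_le k x y" "corner_le k y x"
  shows "x = y"
proof (rule ccontr)
  assume "x \<noteq> y"
  then obtain m where m: "m \<le> k" "\<And>i. i < k \<Longrightarrow> (-1) ^ i * (y (skip m i) - x (skip m i)) > 0"
    using strict_alternation_skip[OF assms(1,2,4) _ assms(3)] by blast
  have "x 0 = y 0" "x k = y k"
    using assms(4,5) by (cases "even k"; auto simp: corner_le_def)+
  then show False
    using m(2)[of 0] m(2)[of "k - 1"] \<open>m \<le> k\<close> \<open>k \<ge> 2\<close>
    by (cases "m = 0") (auto simp: skip_def)
qed

lemma majorizes_of_corner_le:
  assumes x: "x \<in> S_set (k + 1) k s" and y: "y \<in> S_set (k + 1) k s"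
    and le: "corner_le k x y" and "k \<ge> 2"
  shows "majorizes (k + 1) k y x"
proof (cases "x = y")
  case True
  then show ?thesis by (simp add: majorizes_def)
next
  case False
  have "majorizes (Suc k) k y x"
  proof (rule majorizes_of_alternations)
    show "alternations (\<lambda>i. y i - x i) k = k - 1"
      by (rule alternations_corner_le[OF x y le False \<open>k \<ge> 2\<close>])
  qed (use S_setD[OF x] S_setD[OF y] le \<open>k \<ge> 2\<close> in \<open>auto simp: corner_le_def\<close>)
  then show ?thesis by simp
qed

section \<open>Exponential test functions\<close>

lemma higher_deriv_exp:
  "(deriv ^^ j) (\<lambda>t. c * exp (M * t)) = (\<lambda>t. c * M ^ j * exp (M * t :: real))"
proof (induction j)
  case (Suc j)
  have "deriv (\<lambda>t. c * M ^ j * exp (M * t)) t = c * M ^ Suc j * exp (M * t)" for t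
    by (rule DERIV_imp_deriv) (auto intro!: derivative_eq_intros)
  then show ?case by (simp add: Suc.IH ext)
qed simp

text \<open>The factor \<open>c\<close> admits negative \<open>M\<close> together with odd
  \<open>k\<close>, where it has to be nonpositive.\<close>

lemma majorizes_exp:
  assumes "majorizes n k y x" and "c * M ^ k \<ge> (0::real)"
  shows "c * (\<Sum>i<n. exp (M * x i)) \<le> c * (\<Sum>i<n. exp (M * y i))"
proof -
  have "k_times_differentiable k (\<lambda>t. c * exp (M * t))"
    unfolding k_times_differentiable_def higher_deriv_exp
    by (auto intro!: derivative_eq_intros)
  moreover have "(deriv ^^ k) (\<lambda>t. c * exp (M * t)) t \<ge> 0" for t
    using assms(2) by (simp add: higher_deriv_exp)
  ultimately have "(\<Sum>i<n. c * exp (M * x i)) \<le> (\<Sum>i<n. c * exp (M * y i))"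
    using assms(1) unfolding majorizes_def by blast
  then show ?thesis by (simp add: sum_distrib_left)
qed

text \<open>For large \<open>M\<close> the largest entry dominates a sum of exponentials.\<close>

lemma le_of_sum_exp_le:
  fixes u v :: "nat \<Rightarrow> real"
  assumes "\<And>M. M > 0 \<Longrightarrow> (\<Sum>i<n. exp (M * v i)) \<le> (\<Sum>i<n. exp (M * u i))"
    and u: "\<And>i. i < n \<Longrightarrow> u i \<le> c" and "l < n"
  shows "v l \<le> c"
proof (rule ccontr)
  assume "\<not> v l \<le> c"
  then have pos: "v l - c > 0" by simp
  \<comment> \<open>This choice turns the estimate into \<open>exp (real n) \<le> real n\<close>,
    which is false.\<close>
  define M where "M = real n / (v l - c)"
  have "M > 0" using pos \<open>l < n\<close> by (simp add: M_def)
  have "exp (M * v l) \<le> (\<Sum>i<n. exp (M * v i))"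
    using \<open>l < n\<close> by (intro member_le_sum) auto
  also have "\<dots> \<le> (\<Sum>i<n. exp (M * u i))" by (rule assms(1)) fact
  also have "\<dots> \<le> (\<Sum>i<n. exp (M * c))"
    using u \<open>M > 0\<close> by (intro sum_mono) auto
  also have "\<dots> = real n * exp (M * c)" by simp
  finally have "exp (M * v l - M * c) \<le> real n"
    by (simp add: exp_diff divide_le_eq)
  moreover have "M * (v l - c) = real n"
    using pos by (simp add: M_def)
  then have "M * v l - M * c = real n" by (simp add: right_diff_distrib)
  ultimately show False
    using exp_ge_add_one_self[of "real n"] by simp
qed

text \<open>Exponentials with positive rate compare the first coordinates, those with negative rate
  the last ones. For odd \<open>k\<close> a negative rate is used with the factor -1, which reverses
  the second comparison.\<close>

lemma corner_le_of_majorizes: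
  assumes x: "x \<in> S_set (k + 1) k s" and y: "y \<in> S_set (k + 1) k s"
    and maj: "majorizes (k + 1) k y x"
  shows "corner_le k x y"
proof -
  have "x 0 \<le> y 0"
  proof (rule le_of_sum_exp_le)
    show "(\<Sum>i<k + 1. exp (M * x i)) \<le> (\<Sum>i<k + 1. exp (M * y i))" if "M > 0" for M
      using majorizes_exp[OF maj, of 1 M] that by simp
  qed (use S_setD(1)[OF y] in auto)
  moreover have "(-1) ^ k * y k \<le> (-1) ^ k * x k"
  proof (cases "even k")
    case True
    have "- x k \<le> - y k"
    proof (rule le_of_sum_exp_le)
      show "(\<Sum>i<k + 1. exp (M * - x i)) \<le> (\<Sum>i<k + 1. exp (M * - y i))" if "M > 0" for M
        using majorizes_exp[OF maj, of 1 "- M"] that True by simp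
    qed (use S_setD(1)[OF y] in auto)
    then show ?thesis using True by simp
  next
    case False
    have "- y k \<le> - x k"
    proof (rule le_of_sum_exp_le)
      show "(\<Sum>i<k + 1. exp (M * - y i)) \<le> (\<Sum>i<k + 1. exp (M * - x i))" if "M > 0" for M
        using majorizes_exp[OF maj, of "-1" "- M"] that False by simp
    qed (use S_setD(1)[OF x] in auto)
    then show ?thesis using False by simp
  qed
  ultimately show ?thesis by (simp add: corner_le_def)
qed

section \<open>Density of the order\<close>

text \<open>The product \<open>R\<close> vanishes at \<open>v i\<close> and is positive at
  \<open>y i\<close>, so a level \<open>e\<close> below all its values at the \<open>y i\<close> is
  attained between \<open>v i\<close> and \<open>y i\<close>. These \<open>k\<close> points are
  distinct, hence they are all the roots of \<open>R - [:e:]\<close>.\<close>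

lemma perturbed_roots:
  fixes v y :: "nat \<Rightarrow> real"
  assumes v: "\<And>i j. i \<le> j \<Longrightarrow> j < k \<Longrightarrow> v j \<le> v i"
    and y: "\<And>i j. i \<le> j \<Longrightarrow> j < k \<Longrightarrow> y j \<le> y i"
    and alt: "\<And>i. i < k \<Longrightarrow> (-1) ^ i * (y i - v i) > 0" and "k > 0"
  obtains e u where "e > 0" "(\<Prod>i<k. [:- u i, 1:]) = (\<Prod>i<k. [:- v i, 1:]) - [:e:]"
    "\<And>i. i < k \<Longrightarrow> (-1) ^ i * (u i - v i) > 0"
    "\<And>i. i < k \<Longrightarrow> (-1) ^ i * (y i - u i) > 0"
    "\<And>i. i < k \<Longrightarrow> poly (\<Prod>i<k. [:- v i, 1:]) (y i) > e"
proof -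
  define R where "R = (\<Prod>i<k. [:- v i, 1:])"
  have Rv: "poly R (v i) = 0" if "i < k" for i
    using that unfolding R_def poly_prod by (intro prod_zero) auto
  have Ry: "poly R (y i) > 0" if "i < k" for i
  proof -
    \<comment> \<open>\<open>m\<close> is the number of roots \<open>v l\<close> above
      \<open>y i\<close>. It is even in both cases, which makes \<open>R\<close> positive at
      \<open>y i\<close>.\<close>
    define m where "m = (if even i then i else Suc i)"
    have lt: "y i < v l" if "l < m" "l < k" for l
    proof (cases "even i")
      case True
      then have "l < i" using that by (simp add: m_def)
      then obtain i' where i': "i = Suc i'" by (cases i) auto
      have "y i' < v i'" using alt[of i'] True \<open>i < k\<close> i' by auto
      moreover have "y i \<le> y i'" "v i' \<le> v l"
        using v[of l i'] y[of i' i] \<open>i < k\<close> \<open>l < i\<close> i' by auto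
      ultimately show ?thesis by linarith
    next
      case False
      then have "l \<le> i" using that by (simp add: m_def)
      then show ?thesis using v[of l i] alt[of i] False \<open>i < k\<close> by auto
    qed
    have gt: "v l < y i" if "m \<le> l" "l < k" for l
    proof (cases "even i")
      case True
      then have "i \<le> l" using that by (simp add: m_def)
      then show ?thesis using v[of i l] alt[of i] True \<open>l < k\<close> \<open>i < k\<close> by auto
    next
      case False
      then have "Suc i \<le> l" using that by (simp add: m_def)
      then show ?thesis
        using v[of "Suc i" l] y[of i "Suc i"] alt[of "Suc i"] False \<open>l < k\<close> by auto
    qed
    have "m \<le> k" "even m" using \<open>i < k\<close> by (auto simp: m_def)
    have "(-1) ^ m * poly R (y i) \<ge> 0"
      unfolding R_def
    proof (rule sign_separator_prod)
      fix j assume "j < m"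
      then show "y i \<le> v j" using lt[of j] \<open>m \<le> k\<close> by simp
    next
      fix j assume "m \<le> j" "j < k"
      then show "v j \<le> y i" using gt[of j] by simp
    qed fact
    moreover have "y i \<noteq> v l" if "l < k" for l
      using lt[of l] gt[of l] that by (cases "l < m") auto
    then have "poly R (y i) \<noteq> 0"
      unfolding R_def poly_prod by auto
    ultimately show ?thesis using \<open>even m\<close> by simp
  qed
  define e where "e = Min ((\<lambda>i. poly R (y i)) ` {..<k}) / 2"
  have fin: "finite ((\<lambda>i. poly R (y i)) ` {..<k})" "(\<lambda>i. poly R (y i)) ` {..<k} \<noteq> {}"
    using \<open>k > 0\<close> by auto
  have "Min ((\<lambda>i. poly R (y i)) ` {..<k}) > 0"
    using fin Ry by (subst Min_gr_iff) auto
  then have "e > 0" by (simp add: e_def)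
  have e_less: "e < poly R (y i)" if "i < k" for i
  proof -
    have "Min ((\<lambda>i. poly R (y i)) ` {..<k}) \<le> poly R (y i)"
      using fin that by (intro Min_le) auto
    then show ?thesis using \<open>e > 0\<close> unfolding e_def by linarith
  qed
  have "\<exists>t. poly R t = e \<and> (-1) ^ i * (t - v i) > 0 \<and> (-1) ^ i * (y i - t) > 0" if "i < k" for i
  proof (cases "even i")
    case True
    then have "v i < y i" using alt[OF that] by simp
    then have "\<exists>t>v i. t < y i \<and> poly (R - [:e:]) t = 0"
      using Rv[OF that] e_less[OF that] \<open>e > 0\<close> by (intro poly_IVT_pos) auto
    then show ?thesis using True by auto
  next
    case False
    then have "y i < v i" using alt[OF that] by simp
    then have "\<exists>t>y i. t < v i \<and> poly (R - [:e:]) t = 0"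
      using Rv[OF that] e_less[OF that] \<open>e > 0\<close> by (intro poly_IVT_neg) auto
    then show ?thesis using False by auto
  qed
  then obtain u where u: "\<And>i. i < k \<Longrightarrow> poly R (u i) = e"
    "\<And>i. i < k \<Longrightarrow> (-1) ^ i * (u i - v i) > 0" "\<And>i. i < k \<Longrightarrow> (-1) ^ i * (y i - u i) > 0"
    by metis
  \<comment> \<open>Neighbouring new roots are separated by \<open>v i\<close> and
    \<open>v (Suc i)\<close> for even \<open>i\<close>, and by \<open>y i\<close> and
    \<open>y (Suc i)\<close> for odd \<open>i\<close>.\<close>
  have step: "u (Suc i) < u i" if "Suc i < k" for i
  proof (cases "even i")
    case True
    then show ?thesis using u(2)[of i] u(2)[of "Suc i"] v[of i "Suc i"] that by simp
  next
    case False
    then show ?thesis using u(3)[of i] u(3)[of "Suc i"] y[of i "Suc i"] that by simp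
  qed
  have less: "u j < u i" if "i < j" "j < k" for i j
    using that
  proof (induction rule: strict_inc_induct)
    case (base i)
    then show ?case using step[of i] by simp
  next
    case (step i)
    then show ?case using \<open>Suc i < k \<Longrightarrow> u (Suc i) < u i\<close> by simp
  qed
  have inj: "inj_on u {..<k}"
    by (rule linorder_inj_onI) (use less in force)+
  have degR: "degree R = k"
    unfolding R_def by (subst degree_prod_eq_sum_degree) auto
  have degu: "degree (\<Prod>i<k. [:- u i, 1:]) = k"
    by (subst degree_prod_eq_sum_degree) auto
  have "(\<Prod>i<k. [:- u i, 1:]) = R - [:e:]"
  proof (rule poly_eqI_degree_lead_coeff)
    have "lead_coeff R = 1" "lead_coeff (\<Prod>i<k. [:- u i, 1:]) = 1"
      unfolding R_def by (subst lead_coeff_prod; simp)+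
    then show "coeff (\<Prod>i<k. [:- u i, 1:]) k = coeff (R - [:e:]) k"
      using degR degu \<open>k > 0\<close> by (auto simp: coeff_pCons split: nat.splits)
    show "k \<le> card (u ` {..<k})" using inj by (simp add: card_image)
    show "degree (R - [:e:]) \<le> k" using degR by (intro degree_diff_le) auto
    show "degree (\<Prod>i<k. [:- u i, 1:]) \<le> k" using degu by simp
    show "poly (\<Prod>i<k. [:- u i, 1:]) z = poly (R - [:e:]) z" if "z \<in> u ` {..<k}" for z
      using that u(1) by (auto simp: poly_prod intro!: prod_zero)
  qed
  then show ?thesis using that[of e u] \<open>e > 0\<close> u(2,3) e_less unfolding R_def by blast
qed

lemma exists_sorted_rearrangement:
  fixes w :: "nat \<Rightarrow> real"
  obtains z where "\<And>i j. i \<le> j \<Longrightarrow> j < n \<Longrightarrow> z j \<le> z i" "\<And>i. i \<ge> n \<Longrightarrow> z i = 0"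
    "image_mset z (mset_set {..<n}) = image_mset w (mset_set {..<n})"
proof
  define xs where "xs = rev (sort (map w [0..<n]))"
  define z where "z i = (if i < n then xs ! i else 0)" for i
  have len: "length xs = n" by (simp add: xs_def)
  have "sorted_wrt (\<ge>) xs"
    by (simp add: xs_def sorted_wrt_rev)
  then show "z j \<le> z i" if "i \<le> j" "j < n" for i j
    using that len by (cases "i = j") (auto simp: z_def sorted_wrt_iff_nth_less)
  show "z i = 0" if "i \<ge> n" for i using that by (simp add: z_def)
  have "map z [0..<n] = xs" using len by (intro nth_equalityI) (auto simp: z_def)
  then have "image_mset z (mset [0..<n]) = mset xs" by (metis mset_map)
  also have "\<dots> = image_mset w (mset [0..<n])" by (simp add: xs_def)
  finally show "image_mset z (mset_set {..<n}) = image_mset w (mset_set {..<n})"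
    by (simp add: atLeast0LessThan)
qed

lemma bij_betw_skip: "m \<le> k \<Longrightarrow> bij_betw (skip m) {..<k} ({..k} - {m})"
  by (rule bij_betw_byWitness[where f' = "\<lambda>i. if i < m then i else i - 1"])
    (auto simp: skip_def)

text \<open>The new point consists of \<open>x m\<close> and the perturbed roots in sorted order.
  Power sums and the product of linear factors see only this multiset, while the positions of the
  roots between \<open>v\<close> and \<open>y'\<close> control its first and last
  coordinates.\<close>

lemma corner_le_dense:
  assumes x: "x \<in> S_set (k + 1) k s" and y: "y \<in> S_set (k + 1) k s"
    and le: "corner_le k x y" and "x \<noteq> y" and "k \<ge> 2"
  obtains z where "z \<in> S_set (k + 1) k s" "corner_le k x z" "corner_le k z y" "z \<noteq> x" "z \<noteq> y"
proof -
  obtain m where m: "m \<le> k" and alt: "\<And>i. i < k \<Longrightarrow> (-1) ^ i * (y (skip m i) - x (skip m i)) > 0"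
    by (rule strict_alternation_skip[OF assms]) (rule that)
  define v y' where "v i = x (skip m i)" and "y' i = y (skip m i)" for i
  have skip: "skip m i \<le> skip m j" if "i \<le> j" for i j using that by (auto simp: skip_def)
  have skip_le: "skip m i \<le> k" if "i < k" for i using that by (auto simp: skip_def)
  obtain e u where "e > 0" and prod: "(\<Prod>i<k. [:- u i, 1:]) = (\<Prod>i<k. [:- v i, 1:]) - [:e:]"
    and uv: "\<And>i. i < k \<Longrightarrow> (-1) ^ i * (u i - v i) > 0"
    and yu: "\<And>i. i < k \<Longrightarrow> (-1) ^ i * (y' i - u i) > 0"
    and ye: "\<And>i. i < k \<Longrightarrow> poly (\<Prod>i<k. [:- v i, 1:]) (y' i) > e"
  proof (rule perturbed_roots[of k v y'], goal_cases)
    case (1 i j)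
    then show ?case using S_setD(1)[OF x] skip skip_le by (simp add: v_def)
  next
    case (2 i j)
    then show ?case using S_setD(1)[OF y] skip skip_le by (simp add: y'_def)
  next
    case (3 i)
    then show ?case using alt by (simp add: v_def y'_def)
  next
    case 4
    then show ?case using \<open>k \<ge> 2\<close> by simp
  next
    case (5 e u)
    show ?case by (rule 5(1)[OF 5(2-)])
  qed
  define w where "w i = (if i < k then u i else x m)" for i
  obtain z where zs: "\<And>i j. i \<le> j \<Longrightarrow> j < Suc k \<Longrightarrow> z j \<le> z i" "\<And>i. i \<ge> Suc k \<Longrightarrow> z i = 0"
    and mset: "image_mset z (mset_set {..<Suc k}) = image_mset w (mset_set {..<Suc k})"
    using exists_sorted_rearrangement[of "Suc k" w] by metis
  have sum_z: "(\<Sum>i\<le>k. g (z i)) = (\<Sum>i<k. g (u i)) + g (x m)" for g :: "real \<Rightarrow> real"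
  proof -
    have "(\<Sum>i<Suc k. g (z i)) = \<Sum>\<^sub># (image_mset g (image_mset z (mset_set {..<Suc k})))"
      by (simp only: sum_unfold_sum_mset multiset.map_comp o_def)
    also have "\<dots> = (\<Sum>i<Suc k. g (w i))"
      by (simp only: mset sum_unfold_sum_mset multiset.map_comp o_def)
    finally show ?thesis by (simp add: w_def lessThan_Suc_atMost[symmetric])
  qed
  have prod_z: "(\<Prod>i\<le>k. [:- z i, 1:]) = ((\<Prod>i<k. [:- v i, 1:]) - [:e:]) * [:- x m, 1:]"
  proof -
    have "(\<Prod>i<Suc k. [:- z i, 1:]) = \<Prod>\<^sub># (image_mset (\<lambda>a. [:- a, 1:]) (image_mset z (mset_set {..<Suc k})))"
      by (simp only: prod_unfold_prod_mset multiset.map_comp o_def)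
    also have "\<dots> = (\<Prod>i<Suc k. [:- w i, 1:])"
      by (simp only: mset prod_unfold_prod_mset multiset.map_comp o_def)
    finally show ?thesis by (simp add: w_def lessThan_Suc_atMost[symmetric] prod del: mult_pCons_right)
  qed
  have sum_x: "(\<Sum>i\<le>k. g (x i)) = (\<Sum>i<k. g (v i)) + g (x m)" for g :: "real \<Rightarrow> real"
    using sum.reindex_bij_betw[OF bij_betw_skip[OF m], of "\<lambda>i. g (x i)"] m
    by (simp add: v_def sum.remove[of "{..k}" m])
  have prod_x: "(\<Prod>i\<le>k. [:- x i, 1:]) = (\<Prod>i<k. [:- v i, 1:]) * [:- x m, 1:]"
    using prod.reindex_bij_betw[OF bij_betw_skip[OF m], of "\<lambda>i. [:- x i, 1:]"] m
    by (simp add: v_def prod.remove[of "{..k}" m] mult.commute del: mult_pCons_right mult_pCons_left)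
  have image: "z ` {..k} = w ` {..k}"
    using arg_cong[OF mset, of set_mset] by (simp add: lessThan_Suc_atMost)

  have "z \<in> S_set (k + 1) k s"
  proof -
    have "(\<Sum>i\<le>k. z i ^ j) = s j" if "j \<in> {1..k - 1}" for j
    proof -
      \<comment> \<open>Subtracting \<open>e\<close> alters only the coefficient at index 0.\<close>
      have "(\<Sum>i<k. u i ^ j) = (\<Sum>i<k. v i ^ j)"
        using that \<open>k \<ge> 2\<close> by (intro power_sums_eqI) (auto simp: prod)
      then show ?thesis
        using sum_z[of "\<lambda>a. a ^ j"] sum_x[of "\<lambda>a. a ^ j"] S_setD(2)[OF x that] by simp
    qed
    then show ?thesis
      using zs by (auto simp: S_set_def lessThan_Suc_atMost)
  qed
  moreover have "z \<noteq> x"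
  proof
    assume "z = x"
    then have "[:e:] * [:- x m, 1:] = 0"
      using prod_z prod_x by (simp add: left_diff_distrib del: mult_pCons_right mult_pCons_left)
    then show False using \<open>e > 0\<close> by simp
  qed
  moreover have "z \<noteq> y"
  proof
    assume "z = y"
    \<comment> \<open>As these two entries are distinct, some \<open>y' i\<close> differs from
      \<open>x m\<close>. By \<open>ye\<close> it is then not a root of the product over
      \<open>z\<close>.\<close>
    have "y' 1 < y' 0"
      using alt[of 0] alt[of 1] S_setD(1)[OF x, of "skip m 0" "skip m 1"] skip skip_le \<open>k \<ge> 2\<close>
      by (simp add: y'_def)
    then obtain i where i: "i < k" "y' i \<noteq> x m"
      using \<open>k \<ge> 2\<close> by (metis less_irrefl less_le_trans one_less_numeral_iff zero_less_numeral semiring_norm(76))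
    have "poly (\<Prod>i\<le>k. [:- z i, 1:]) (y' i) = 0"
      using skip_le[OF i(1)] \<open>z = y\<close> unfolding poly_prod y'_def by (intro prod_zero) auto
    then show False using ye[OF i(1)] i(2) unfolding prod_z by simp
  qed
  moreover
  have x0: "x i \<le> x 0" "x k \<le> x i" "y i \<le> y 0" "y k \<le> y i" if "i \<le> k" for i
    using S_setD(1)[OF x] S_setD(1)[OF y] that by auto
  have v0: "v i \<le> x 0" "x k \<le> v i" "y' i \<le> y 0" "y k \<le> y' i" if "i < k" for i
    using x0[OF skip_le[OF that]] by (auto simp: v_def y'_def)
  have z_cases: "(\<exists>l<k. z i = u l) \<or> z i = x m" if "i \<le> k" for i
  proof -
    have "z i \<in> w ` {..k}" using image that by blast
    then show ?thesis by (auto simp: w_def)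
  qed
  have z_bounds: "z k \<le> a" "a \<le> z 0" if "a = x m \<or> (\<exists>l<k. a = u l)" for a
  proof -
    have "a = w k \<or> (\<exists>l<k. a = w l)" using that by (auto simp: w_def)
    then have "a \<in> w ` {..k}" by (auto intro: less_imp_le)
    then obtain i where "i \<le> k" "a = z i" using image by auto
    then show "z k \<le> a" "a \<le> z 0" using zs(1) by auto
  qed
  have top_le: "x 0 \<le> y 0" using le by (simp add: corner_le_def)
  have ui: "v l < u l \<and> u l < y' l" if "l < k" "even l" for l
    using uv[OF that(1)] yu[OF that(1)] that(2) by simp
  have ui': "u l < v l \<and> y' l < u l" if "l < k" "odd l" for l
    using uv[OF that(1)] yu[OF that(1)] that(2) by simp
  have z0: "x 0 \<le> z 0" "z 0 \<le> y 0"
  proof -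
    show "x 0 \<le> z 0"
    proof (cases "m = 0")
      case True
      then show ?thesis using z_bounds(2) by auto
    next
      case False
      then have "v 0 = x 0" by (simp add: v_def skip_def)
      then show ?thesis
        using ui[of 0] z_bounds(2)[of "u 0"] \<open>k \<ge> 2\<close> by force
    qed
    have "u l \<le> y 0" if "l < k" for l
      using ui[OF that] ui'[OF that] v0[OF that] top_le by (cases "even l") auto
    then show "z 0 \<le> y 0" using z_cases[of 0] x0(1)[OF m] top_le by auto
  qed
  \<comment> \<open>If the last coordinate is the kept one, \<open>x k\<close> is an entry of
    \<open>z\<close>. Otherwise the shortened sequences end in \<open>x k\<close> and
    \<open>y k\<close>, and the root \<open>u (k - 1)\<close> lies between these two.\<close>
  have last: "m = k \<or> (v (k - 1) = x k \<and> y' (k - 1) = y k)"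
    using m \<open>k \<ge> 2\<close> by (auto simp: v_def y'_def skip_def)
  have zk: "(-1) ^ k * y k \<le> (-1) ^ k * z k \<and> (-1) ^ k * z k \<le> (-1) ^ k * x k"
  proof (cases "even k")
    case True
    then have xy: "y k \<le> x k" using le by (simp add: corner_le_def)
    have "odd (k - 1)" using True \<open>k \<ge> 2\<close> by auto
    then have "z k \<le> x k"
      using last ui'[of "k - 1"] z_bounds(1)[of "u (k - 1)"] z_bounds(1)[of "x m"] \<open>k \<ge> 2\<close> by force
    moreover have "y k \<le> u l" if "l < k" for l
      using ui[OF that] ui'[OF that] v0[OF that] xy by (cases "even l") auto
    then have "y k \<le> z k" using z_cases[of k] x0(2)[OF m] xy by auto
    ultimately show ?thesis using True by simp
  next
    case False
    then have xy: "x k \<le> y k" using le by (simp add: corner_le_def)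
    have "even (k - 1)" using False by auto
    then have "z k \<le> y k"
      using last ui[of "k - 1"] z_bounds(1)[of "u (k - 1)"] z_bounds(1)[of "x m"] xy \<open>k \<ge> 2\<close> by force
    moreover have "x k \<le> u l" if "l < k" for l
      using ui[OF that] ui'[OF that] v0[OF that] xy by (cases "even l") auto
    then have "x k \<le> z k" using z_cases[of k] x0(2)[OF m] by auto
    ultimately show ?thesis using False by simp
  qed
  have "corner_le k x z" "corner_le k z y"
    using z0 zk by (auto simp: corner_le_def)
  ultimately show ?thesis using that by blast
qed

section \<open>A maximal chain as a path\<close>

lemma continuous_on_coordinate [continuous_intros]:
  "continuous_on A (\<lambda>x::nat \<Rightarrow> real. x i)"
  by (rule continuous_on_subset[OF continuous_on_product_coordinates]) simp

text \<open>The second power sum is fixed because \<open>k \<ge> 3\<close>, and it bounds every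
  coordinate; those from \<open>n\<close> on vanish. So the set is closed inside a product of
  compact intervals over all of \<open>nat\<close>, compact by Tychonoff's theorem.\<close>

lemma compact_S_set:
  assumes "k \<ge> 3"
  shows "compact (S_set n k s)"
proof -
  have "S_set n k s = (\<Inter>i\<in>{n..}. {x. x i = 0}) \<inter> (\<Inter>j\<in>{..<n}. \<Inter>i\<in>{..j}. {x. x j \<le> x i}) \<inter>
      (\<Inter>j\<in>{1..k - 1}. {x. (\<Sum>i<n. x i ^ j) = s j})"
    by (auto simp: S_set_def)
  also have "closed \<dots>"
    by (intro closed_Int closed_INT ballI closed_Collect_eq closed_Collect_le continuous_intros)
  finally have "closed (S_set n k s)" .
  moreover have "compact (PiE UNIV (\<lambda>_::nat. {- (1 + \<bar>s 2\<bar>)..1 + \<bar>s 2\<bar>}))"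
    using compactin_PiE[of "\<lambda>_. euclidean" UNIV "\<lambda>_::nat. {- (1 + \<bar>s 2\<bar>)..1 + \<bar>s 2\<bar>}"]
    by (simp add: euclidean_product_topology)
  moreover have "S_set n k s \<subseteq> PiE UNIV (\<lambda>_::nat. {- (1 + \<bar>s 2\<bar>)..1 + \<bar>s 2\<bar>})"
  proof
    fix x assume x: "x \<in> S_set n k s"
    have "\<bar>x i\<bar> \<le> 1 + \<bar>s 2\<bar>" for i
    proof (cases "i < n")
      case True
      have "(x i)\<^sup>2 \<le> (\<Sum>i<n. (x i)\<^sup>2)"
        using member_le_sum[of i "{..<n}" "\<lambda>i. (x i)\<^sup>2"] True by simp
      also have "\<dots> = s 2" using x \<open>k \<ge> 3\<close> by (auto simp: S_set_def)
      finally have "(x i)\<^sup>2 \<le> \<bar>s 2\<bar>" by simp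
      moreover have "\<bar>x i\<bar> \<le> 1 + (x i)\<^sup>2"
        using zero_le_power2[of "\<bar>x i\<bar> - 1"] zero_le_power2[of "x i"]
        by (simp add: power2_diff)
      ultimately show ?thesis by linarith
    next
      case False
      then show ?thesis using x by (simp add: S_set_def)
    qed
    then have "x i \<in> {- (1 + \<bar>s 2\<bar>)..1 + \<bar>s 2\<bar>}" for i
      unfolding atLeastAtMost_iff abs_le_iff by (metis minus_le_iff)
    then show "x \<in> PiE UNIV (\<lambda>_::nat. {- (1 + \<bar>s 2\<bar>)..1 + \<bar>s 2\<bar>})"
      by blast
  qed
  ultimately show ?thesis
    by (metis closed_Int_compact inf.absorb1)
qed

lemma closed_corner_le: "closed {z. corner_le k y z}" "closed {z. corner_le k z y}"
  unfolding corner_le_def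
  by (intro closed_Collect_conj closed_Collect_le continuous_intros)+

lemma corner_le_refl: "corner_le k x x"
  by (simp add: corner_le_def)

lemma corner_le_trans: "corner_le k x y \<Longrightarrow> corner_le k y z \<Longrightarrow> corner_le k x z"
  by (auto simp: corner_le_def)

text \<open>By Zorn's lemma. Maximality is phrased for single points, since this form makes the
  chain closed and rules out gaps.\<close>

lemma maximal_corner_chain:
  obtains C where "C \<subseteq> T" "\<And>x y. x \<in> C \<Longrightarrow> y \<in> C \<Longrightarrow> corner_le k x y \<or> corner_le k y x"
    "\<And>z. z \<in> T \<Longrightarrow> (\<And>y. y \<in> C \<Longrightarrow> corner_le k y z \<or> corner_le k z y) \<Longrightarrow> z \<in> C"
proof -
  define \<A> where "\<A> = {C. C \<subseteq> T \<and> (\<forall>x\<in>C. \<forall>y\<in>C. corner_le k x y \<or> corner_le k y x)}"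
  have "\<exists>M\<in>\<A>. \<forall>X\<in>\<A>. M \<subseteq> X \<longrightarrow> X = M"
  proof (rule subset_Zorn')
    fix \<C> assume "subset.chain \<A> \<C>"
    then have sub: "\<C> \<subseteq> \<A>" and ch: "\<And>X Y. X \<in> \<C> \<Longrightarrow> Y \<in> \<C> \<Longrightarrow> X \<subseteq> Y \<or> Y \<subseteq> X"
      by (auto simp: subset_chain_def)
    have "corner_le k x y \<or> corner_le k y x" if xy: "x \<in> \<Union>\<C>" "y \<in> \<Union>\<C>" for x y
    proof -
      obtain X Y where XY: "x \<in> X" "y \<in> Y" "X \<in> \<C>" "Y \<in> \<C>" using xy by blast
      then have "\<exists>Z\<in>\<C>. x \<in> Z \<and> y \<in> Z" using ch[of X Y] by blast
      then show ?thesis using sub unfolding \<A>_def by blast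
    qed
    moreover have "\<Union>\<C> \<subseteq> T" using sub unfolding \<A>_def by blast
    ultimately show "\<Union>\<C> \<in> \<A>" unfolding \<A>_def by blast
  qed
  then obtain C where C: "C \<in> \<A>" and max: "\<And>X. X \<in> \<A> \<Longrightarrow> C \<subseteq> X \<Longrightarrow> X = C" by blast
  have "z \<in> C" if z: "z \<in> T" and cmp: "\<And>y. y \<in> C \<Longrightarrow> corner_le k y z \<or> corner_le k z y" for z
  proof -
    have "corner_le k x y \<or> corner_le k y x" if "x \<in> insert z C" "y \<in> insert z C" for x y
      using that cmp C corner_le_refl unfolding \<A>_def by blast
    then have "insert z C \<in> \<A>" using C z unfolding \<A>_def by blast
    then show ?thesis using max[of "insert z C"] by blast
  qed
  then show ?thesis using that[of C] C unfolding \<A>_def by blast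
qed

text \<open>The two quantities compared by \<open>corner_le\<close>, the second with its sign
  reversed, are added to give one real parameter along a chain.\<close>

definition corner_height :: "nat \<Rightarrow> (nat \<Rightarrow> real) \<Rightarrow> real" where
  "corner_height k z = z 0 - (-1) ^ k * z k"

lemma corner_height_mono: "corner_le k x y \<Longrightarrow> corner_height k x \<le> corner_height k y"
  by (auto simp: corner_le_def corner_height_def)

text \<open>If only the opposite comparison were known, neither summand of the height could increase
  from \<open>x\<close> to \<open>y\<close>. As the total does not drop, both are equal.\<close>

lemma corner_le_of_corner_height:
  assumes "corner_le k x y \<or> corner_le k y x" "corner_height k x \<le> corner_height k y"
  shows "corner_le k x y"
  using assms by (auto simp: corner_le_def corner_height_def)

lemma continuous_on_corner_height: "continuous_on A (corner_height k)"
  unfolding corner_height_def by (intro continuous_intros)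

text \<open>If a height \<open>v\<close> were missed, compactness would give chain points
  \<open>c1\<close> and \<open>c2\<close> with heights nearest to \<open>v\<close> from below and
  above. A point strictly between them exists by density, is comparable with the whole chain and so
  belongs to it, against the choice of \<open>c1\<close> and \<open>c2\<close>.\<close>

lemma corner_chain_no_gap:
  fixes a b s :: "nat \<Rightarrow> real" and k :: nat
  defines "T \<equiv> {z \<in> S_set (k + 1) k s. corner_le k b z \<and> corner_le k z a}"
  assumes "k \<ge> 2" and "compact C" "C \<subseteq> T" "a \<in> C" "b \<in> C"
    and chain: "\<And>x y. x \<in> C \<Longrightarrow> y \<in> C \<Longrightarrow> corner_le k x y \<or> corner_le k y x"
    and max: "\<And>z. z \<in> T \<Longrightarrow> (\<And>y. y \<in> C \<Longrightarrow> corner_le k y z \<or> corner_le k z y) \<Longrightarrow> z \<in> C"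
  shows "corner_height k ` C = {corner_height k b..corner_height k a}"
proof (intro equalityI subsetI)
  fix v assume "v \<in> corner_height k ` C"
  then show "v \<in> {corner_height k b..corner_height k a}"
    using \<open>C \<subseteq> T\<close> corner_height_mono unfolding T_def by auto
next
  fix v assume v: "v \<in> {corner_height k b..corner_height k a}"
  let ?h = "corner_height k"
  show "v \<in> ?h ` C"
  proof (rule ccontr)
    assume nv: "v \<notin> ?h ` C"
    have cl: "closed {z. ?h z \<le> v}" "closed {z. v \<le> ?h z}"
      by (intro closed_Collect_le continuous_on_corner_height continuous_on_const)+
    have "compact (C \<inter> {z. ?h z \<le> v})" "C \<inter> {z. ?h z \<le> v} \<noteq> {}"
      using \<open>compact C\<close> cl \<open>b \<in> C\<close> v by (auto intro: compact_Int_closed)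
    then obtain c1 where c1: "c1 \<in> C" "?h c1 \<le> v" "\<And>c. c \<in> C \<Longrightarrow> ?h c \<le> v \<Longrightarrow> ?h c \<le> ?h c1"
      using continuous_attains_sup[OF _ _ continuous_on_corner_height, of "C \<inter> {z. ?h z \<le> v}" k]
      by auto
    have "compact (C \<inter> {z. v \<le> ?h z})" "C \<inter> {z. v \<le> ?h z} \<noteq> {}"
      using \<open>compact C\<close> cl \<open>a \<in> C\<close> v by (auto intro: compact_Int_closed)
    then obtain c2 where c2: "c2 \<in> C" "v \<le> ?h c2" "\<And>c. c \<in> C \<Longrightarrow> v \<le> ?h c \<Longrightarrow> ?h c2 \<le> ?h c"
      using continuous_attains_inf[OF _ _ continuous_on_corner_height, of "C \<inter> {z. v \<le> ?h z}" k]
      by auto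
    have "?h c1 \<noteq> v" "?h c2 \<noteq> v" using nv c1(1) c2(1) by auto
    then have lt: "?h c1 < v" "v < ?h c2" using c1(2) c2(2) by auto
    have le: "corner_le k c1 c2" using chain[OF c1(1) c2(1)] lt by (intro corner_le_of_corner_height) auto
    have S: "c1 \<in> S_set (k + 1) k s" "c2 \<in> S_set (k + 1) k s"
      using c1(1) c2(1) \<open>C \<subseteq> T\<close> unfolding T_def by auto
    have "c1 \<noteq> c2" using lt by auto
    obtain z where z: "z \<in> S_set (k + 1) k s" "corner_le k c1 z" "corner_le k z c2" "z \<noteq> c1" "z \<noteq> c2"
      by (rule corner_le_dense[OF S le \<open>c1 \<noteq> c2\<close> \<open>k \<ge> 2\<close>])
    have "corner_le k c z \<or> corner_le k z c" if "c \<in> C" for c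
    proof (cases "?h c \<le> v")
      case True
      then have "corner_le k c c1"
        using chain[OF that c1(1)] c1(3)[OF that] by (intro corner_le_of_corner_height) auto
      then show ?thesis using z(2) corner_le_trans by blast
    next
      case False
      then have "corner_le k c2 c"
        using chain[OF c2(1) that] c2(3)[OF that] by (intro corner_le_of_corner_height) auto
      then show ?thesis using z(3) corner_le_trans by blast
    qed
    moreover have "z \<in> T"
      using z c1(1) c2(1) \<open>C \<subseteq> T\<close> corner_le_trans unfolding T_def by blast
    ultimately have "z \<in> C" using max by blast
    show False
    proof (cases "?h z \<le> v")
      case True
      then have "corner_le k z c1"
        using z(2) c1(3)[OF \<open>z \<in> C\<close>] by (intro corner_le_of_corner_height) auto
      then show False using corner_le_antisym[OF z(1) S(1) \<open>k \<ge> 2\<close>] z(2,4) by blast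
    next
      case False
      then have "corner_le k c2 z"
        using z(3) c2(3)[OF \<open>z \<in> C\<close>] by (intro corner_le_of_corner_height) auto
      then show False using corner_le_antisym[OF z(1) S(2) \<open>k \<ge> 2\<close>] z(3,5) by blast
    qed
  qed
qed

theorem mainTheorem17:
  fixes k n :: nat and s :: "nat \<Rightarrow> real" and a b :: "nat \<Rightarrow> real"
  assumes "k \<ge> 3" and "n = k + 1"
    and "a \<in> S_set n k s" and "b \<in> S_set n k s"
    and "majorizes n k a b"
  shows "\<exists>p :: real \<Rightarrow> nat \<Rightarrow> real.
           (\<forall>i<n. continuous_on {0..1} (\<lambda>t. p t i)) \<and>
           (\<forall>t\<in>{0..1}. p t \<in> S_set n k s) \<and>
           p 0 = b \<and> p 1 = a \<and>
           (\<forall>t0\<in>{0..1}. \<forall>t1\<in>{0..1}. t1 \<ge> t0 \<longrightarrow> majorizes n k (p t1) (p t0))"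
proof -
  let ?S = "S_set (k + 1) k s" and ?h = "corner_height k"
  have a: "a \<in> ?S" and b: "b \<in> ?S" and "k \<ge> 2" using assms by auto
  have ba: "corner_le k b a"
    using corner_le_of_majorizes[OF b a] assms by simp
  define T where "T = {z \<in> ?S. corner_le k b z \<and> corner_le k z a}"
  obtain C where C: "C \<subseteq> T" and chain: "\<And>x y. x \<in> C \<Longrightarrow> y \<in> C \<Longrightarrow> corner_le k x y \<or> corner_le k y x"
    and max: "\<And>z. z \<in> T \<Longrightarrow> (\<And>y. y \<in> C \<Longrightarrow> corner_le k y z \<or> corner_le k z y) \<Longrightarrow> z \<in> C"
    using maximal_corner_chain[of T k] by metis
  have CS: "C \<subseteq> ?S" using C unfolding T_def by blast
  have "a \<in> C" "b \<in> C"
    using C a b ba corner_le_refl by (auto intro!: max simp: T_def)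
  \<comment> \<open>Lying between \<open>b\<close> and \<open>a\<close> and being comparable with
    every chain point are closed conditions. Maximality makes the chain equal to
    \<open>?S \<inter> X\<close>, hence compact.\<close>
  define X where "X = ({z. corner_le k b z} \<inter> {z. corner_le k z a}) \<inter>
      (\<Inter>y\<in>C. {z. corner_le k y z} \<union> {z. corner_le k z y})"
  have "closed X"
    unfolding X_def by (intro closed_Int closed_INT ballI closed_Un closed_corner_le)
  then have "compact (?S \<inter> X)"
    using compact_S_set[OF \<open>k \<ge> 3\<close>] by (rule compact_Int_closed[rotated])
  moreover have "C = ?S \<inter> X"
  proof
    show "C \<subseteq> ?S \<inter> X" using C chain unfolding X_def T_def by blast
    show "?S \<inter> X \<subseteq> C"
    proof
      fix z assume "z \<in> ?S \<inter> X"
      then show "z \<in> C" unfolding X_def by (intro max) (auto simp: T_def)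
    qed
  qed
  ultimately have "compact C" by simp
  have image: "?h ` C = {?h b..?h a}"
    by (rule corner_chain_no_gap[OF \<open>k \<ge> 2\<close> \<open>compact C\<close> C[unfolded T_def] \<open>a \<in> C\<close> \<open>b \<in> C\<close> chain max[unfolded T_def]])
  have le: "corner_le k x y" if "x \<in> C" "y \<in> C" "?h x \<le> ?h y" for x y
    using corner_le_of_corner_height[OF chain] that by blast
  have inj: "inj_on ?h C"
  proof (rule inj_onI)
    fix x y assume "x \<in> C" "y \<in> C" "?h x = ?h y"
    then show "x = y" using le[of x y] le[of y x] corner_le_antisym[OF _ _ \<open>k \<ge> 2\<close>] CS by auto
  qed
  \<comment> \<open>On the compact chain the injective continuous height has a continuous inverse.
    The path is this inverse along the affine parameter from the height of \<open>b\<close> to that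
    of \<open>a\<close>.\<close>
  define g where "g = inv_into C ?h"
  define \<gamma> where "\<gamma> t = ?h b + t * (?h a - ?h b)" for t
  define p where "p t = g (\<gamma> t)" for t
  have hba: "?h b \<le> ?h a" by (rule corner_height_mono[OF ba])
  have \<gamma>: "\<gamma> t \<in> ?h ` C" if "t \<in> {0..1}" for t
  proof -
    have "t * (?h a - ?h b) \<le> 1 * (?h a - ?h b)" "0 \<le> t * (?h a - ?h b)"
      using that hba by (intro mult_right_mono mult_nonneg_nonneg; simp)+
    then show ?thesis unfolding image \<gamma>_def by simp
  qed
  have pC: "p t \<in> C" and hp: "?h (p t) = \<gamma> t" if "t \<in> {0..1}" for t
    using \<gamma>[OF that] unfolding p_def g_def by (rule inv_into_into, rule f_inv_into_f)
  have "continuous_on (?h ` C) g"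
    using inj by (intro continuous_on_inv[OF continuous_on_corner_height \<open>compact C\<close>]) (simp add: g_def)
  then have cont: "continuous_on {0..1} p"
    unfolding p_def by (rule continuous_on_compose2) (use \<gamma> in \<open>auto simp: \<gamma>_def intro!: continuous_intros\<close>)
  have "majorizes n k (p t1) (p t0)" if "t0 \<in> {0..1}" "t1 \<in> {0..1}" "t0 \<le> t1" for t0 t1
  proof -
    have "\<gamma> t0 \<le> \<gamma> t1" using that hba by (auto simp: \<gamma>_def intro!: mult_right_mono)
    then have "corner_le k (p t0) (p t1)" using le[OF pC pC] hp that by simp
    then show ?thesis using majorizes_of_corner_le[OF _ _ _ \<open>k \<ge> 2\<close>] pC that CS assms(2) by blast
  qed
  moreover have "p 0 = b" "p 1 = a"
    using inj \<open>a \<in> C\<close> \<open>b \<in> C\<close> by (auto simp: p_def \<gamma>_def g_def)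
  moreover have "\<forall>t\<in>{0..1}. p t \<in> S_set n k s" using pC CS assms(2) by blast
  moreover have "\<forall>i<n. continuous_on {0..1} (\<lambda>t. p t i)"
    using continuous_on_product_then_coordinatewise[OF cont] by blast
  ultimately show ?thesis by blast
qed

end
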